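(* In the asymptotic setting ($M,N\to\infty$) described in the context, let $S:[0,1]\times\{0,1\}\to\mathbb R$ be a strictly proper scoring rule and consider the SSR mechanism built on $S$. If the reference report $z$ of agent $i$ is informative, i.e. $e_z^++e_z^-\ne1$, then for every task $k$ and every report $q_{i,k}\in[0,1]$ the expected score of the SSR mechanism equals the expected score under the strictly proper scoring rule $S$ with access to the ground truth: $$\mathbb E[R(q_{i,k},z)]=\mathbb E[S(q_{i,k},y_k)],$$ where the expectation is over $y_k$ (under the prior, or conditional on any realization of agent $i$'s signal $o_{i,k}$) and over $z$ given $y_k$.
   Context: Strictly proper scoring rule: $S:[0,1]\times\{0,1\}\to\mathbb R$ with $\mathbb E_{y\sim \mathrm{Bernoulli}(p)}[S(p,y)]>\mathbb E_{y\sim \mathrm{Bernoulli}(p)}[S(q,y)]$ for all $p\ne q$ in $[0,1]$. Setting. Task $k$ has an unobserved ground truth $y_k\in\{0,1\}$ with common prior $p=\Pr[y_k=1]\in(0,1)$, $p\ne\frac12$, and the principal knows $\mathbb 1(p>0.5)$. Agent $i$ observes a private signal $o_{i,k}$ in a finite set. The vectors $(o_{1,k},o_{2,k},\dots,y_k)$ are i.i.d. over tasks $k$, and for each $k$ the signals are mutually independent conditional on $y_k$. Posterior beliefs are $p_{i,k}=\Pr[y_k=1\mid o_{i,k}]$. Agent $i$ uses one strategy $\sigma_i$ (mapping beliefs in $[0,1]$ to distributions on $[0,1]$) on all tasks and reports $q_{i,k}\sim\sigma_i(p_{i,k})$, with independent randomization. The prediction signal of agent $j$ is $s_{j,k}\sim\mathrm{Bernoulli}(q_{j,k})$,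 and the reference report $z=z_{i,k}$ of agent $i$ is the prediction signal on task $k$ of a uniformly random agent $j\neq i$. Given $y_k$, $z$ is independent of $o_{i,k}$, with error rates $e_z^+=\Pr[z=0\mid y_k=1]$, $e_z^-=\Pr[z=1\mid y_k=0]$ that are the same for all tasks. Asymptotic setting. With infinitely many tasks and agents, three prediction signals $z_1,z_2,z_3$ drawn from different random peers of $i$ on a task are conditionally independent given the ground truth with the same error rates as $z$, and the principal knows exactly $$\alpha=\Pr[z=1]=p(1-e_z^+)+(1-p)e_z^-,\quad \beta=\Pr[z_1=z_2=1]=p(1-e_z^+)^2+(1-p)(e_z^-)^2,\quad \gamma=\Pr[z_1=z_2=z_3=1]=p(1-e_z^+)^3+(1-p)(e_z^-)^3 .$$ SSR mechanism. The principal solves these three equations for $(p,e_z^-,e_z^+)$, using the known bit $\mathbb 1(p>0.5)$ to select the solution, and with the resulting values pays agent $i$ for the report $q_{i,k}$ the score $$R(q,1)=\frac{(1-e_z^-)S(q,1)-e_z^+S(q,0)}{1-e_z^+-e_z^-},\qquad R(q,0)=\frac{(1-e_z^+)S(q,0)-e_z^-S(q,1)}{1-e_z^+-e_z^-}$$ evaluated at $(q_{i,k},z)$ if $e_z^++e_z^-\ne1$, and pays $0$ if $e_z^++e_z^-=1$ (equivalently $\beta=\alpha^2$). *)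

theory Defs
  imports "HOL-Probability.Probability"
begin

text \<open>Only the values \<open>S q b\<close> with \<open>q \<in> {0..1}\<close> are meaningful; outcomes and binary reports are
  booleans, with \<open>True\<close> for \<open>1\<close>.\<close>

definition strictly_proper :: "(real \<Rightarrow> bool \<Rightarrow> real) \<Rightarrow> bool" where
  "strictly_proper S \<longleftrightarrow>
    (\<forall>p\<in>{0..1}. \<forall>q\<in>{0..1}. p \<noteq> q \<longrightarrow>
      measure_pmf.expectation (bernoulli_pmf p) (S p) > measure_pmf.expectation (bernoulli_pmf p) (S q))"

definition posterior :: "'w measure \<Rightarrow> ('w \<Rightarrow> bool) \<Rightarrow> ('w \<Rightarrow> 's) \<Rightarrow> 's \<Rightarrow> real" where
  "posterior M Y X v = \<P>(w in M. Y w \<bar> X w = v)"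

text \<open>Agents and tasks are both indexed by the natural numbers. \<open>y k\<close> is the ground truth of task \<open>k\<close>;
  \<open>obs j k\<close>, \<open>rpt j k\<close> and \<open>s j k\<close> are the private signal, the report and the prediction signal of
  agent \<open>j\<close> on task \<open>k\<close>. \<open>uniform_measure M A\<close> is \<open>M\<close> conditioned on \<open>A\<close>.

  The assumption \<open>reports\<close> is the conditional law of the reports and prediction signals given the
  private signals and the ground truths: for the agents in a finite set \<open>A\<close> and the tasks in a finite
  set \<open>K\<close> these pairs are independent, the report having law \<open>\<sigma> j\<close> of the posterior and the
  prediction signal being Bernoulli with the report as parameter. Since signals are finite-valued,
  events of the form \<open>E\<close> below determine the conditional law.\<close>

locale elicitation = prob_space M
  for M :: "'w measure" +
  fixes p :: real
    and Sig :: "nat \<Rightarrow> 's set"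
    and y :: "nat \<Rightarrow> 'w \<Rightarrow> bool"
    and obs :: "nat \<Rightarrow> nat \<Rightarrow> 'w \<Rightarrow> 's"
    and \<sigma> :: "nat \<Rightarrow> real \<Rightarrow> real measure"
    and rpt :: "nat \<Rightarrow> nat \<Rightarrow> 'w \<Rightarrow> real"
    and s :: "nat \<Rightarrow> nat \<Rightarrow> 'w \<Rightarrow> bool"
  assumes prior_range: "0 < p" "p < 1" "p \<noteq> 1/2"
    and prior: "\<And>k. \<P>(w in M. y k w) = p"
    and finite_signals: "\<And>j. finite (Sig j)"
    and tasks_indep:
      "indep_vars (\<lambda>_. (\<Pi>\<^sub>M j\<in>UNIV. count_space (Sig j)) \<Otimes>\<^sub>M count_space UNIV)
         (\<lambda>k w. (\<lambda>j. obs j k w, y k w)) UNIV"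
    and tasks_ident:
      "\<And>k l. distr M ((\<Pi>\<^sub>M j\<in>UNIV. count_space (Sig j)) \<Otimes>\<^sub>M count_space UNIV) (\<lambda>w. (\<lambda>j. obs j k w, y k w))
            = distr M ((\<Pi>\<^sub>M j\<in>UNIV. count_space (Sig j)) \<Otimes>\<^sub>M count_space UNIV) (\<lambda>w. (\<lambda>j. obs j l w, y l w))"
    and signals_cond_indep:
      "\<And>k b. prob_space.indep_vars (uniform_measure M {w \<in> space M. y k w = b})
         (\<lambda>j. count_space (Sig j)) (\<lambda>j. obs j k) UNIV"
    and strategy: "\<And>j x. x \<in> {0..1} \<Longrightarrow> \<sigma> j x \<in> space (prob_algebra (restrict_space borel {0..1}))"
    and rpt_measurable: "\<And>j k. rpt j k \<in> measurable M (restrict_space borel {0..1})"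
    and s_measurable: "\<And>j k. s j k \<in> measurable M (count_space UNIV)"
    and reports:
      "\<And>A K v b B c E. \<lbrakk>finite A; finite K; \<And>j k. B j k \<in> sets borel;
          E = {w \<in> space M. \<forall>k\<in>K. y k w = b k \<and> (\<forall>j\<in>A. obs j k w = v j k)}\<rbrakk> \<Longrightarrow>
        prob {w \<in> E. \<forall>j\<in>A. \<forall>k\<in>K. rpt j k w \<in> B j k \<and> s j k w = c j k}
        = prob E * (\<Prod>j\<in>A. \<Prod>k\<in>K.
            LINT x:B j k|\<sigma> j (posterior M (y k) (obs j k) (v j k)). pmf (bernoulli_pmf x) (c j k))"

definition peers :: "nat \<Rightarrow> nat \<Rightarrow> nat set" where
  "peers N i = {..<N} - {i}"

definition peer_triples :: "nat \<Rightarrow> nat \<Rightarrow> (nat \<times> nat \<times> nat) set" where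
  "peer_triples N i =
    {(j1, j2, j3). j1 \<in> peers N i \<and> j2 \<in> peers N i \<and> j3 \<in> peers N i \<and> j1 \<noteq> j2 \<and> j1 \<noteq> j3 \<and> j2 \<noteq> j3}"

text \<open>There is no uniform distribution on an infinite set of peers, so the reference report \<open>z i k\<close>
  of agent \<open>i\<close> on task \<open>k\<close> is a variable whose joint law with \<open>(obs i k, y k)\<close> is the limit, as the
  number \<open>N\<close> of agents tends to infinity, of the law obtained by drawing a peer \<open>j\<close> uniformly (and
  independently of everything else) and taking \<open>s j k\<close>. In the same way \<open>z1, z2, z3\<close> are the limits
  of the prediction signals of three different random peers. The conditional independence of these
  variables given \<open>y k\<close> and the equality of their error rates across tasks are consequences.\<close>

locale asymptotic_elicitation = elicitation M p Sig y obs \<sigma> rpt s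
  for M :: "'w measure" and p :: real and Sig :: "nat \<Rightarrow> 's set" and y obs \<sigma> rpt s +
  fixes z z1 z2 z3 :: "nat \<Rightarrow> nat \<Rightarrow> 'w \<Rightarrow> bool"
  assumes z_measurable:
      "\<And>i k. z i k \<in> measurable M (count_space UNIV)"
      "\<And>i k. z1 i k \<in> measurable M (count_space UNIV)"
      "\<And>i k. z2 i k \<in> measurable M (count_space UNIV)"
      "\<And>i k. z3 i k \<in> measurable M (count_space UNIV)"
    and z_limit:
      "\<And>i k v b c.
        (\<lambda>N. measure_pmf.expectation (pmf_of_set (peers N i))
               (\<lambda>j. \<P>(w in M. obs i k w = v \<and> y k w = b \<and> s j k w = c)))
        \<longlonglongrightarrow> \<P>(w in M. obs i k w = v \<and> y k w = b \<and> z i k w = c)"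
    and z123_limit:
      "\<And>i k b c1 c2 c3.
        (\<lambda>N. measure_pmf.expectation (pmf_of_set (peer_triples N i))
               (\<lambda>(j1, j2, j3). \<P>(w in M. y k w = b \<and> s j1 k w = c1 \<and> s j2 k w = c2 \<and> s j3 k w = c3)))
        \<longlonglongrightarrow> \<P>(w in M. y k w = b \<and> z1 i k w = c1 \<and> z2 i k w = c2 \<and> z3 i k w = c3)"

definition err_plus :: "'w measure \<Rightarrow> ('w \<Rightarrow> bool) \<Rightarrow> ('w \<Rightarrow> bool) \<Rightarrow> real" where
  "err_plus M Y Z = \<P>(w in M. \<not> Z w \<bar> Y w)"

definition err_minus :: "'w measure \<Rightarrow> ('w \<Rightarrow> bool) \<Rightarrow> ('w \<Rightarrow> bool) \<Rightarrow> real" where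
  "err_minus M Y Z = \<P>(w in M. Z w \<bar> \<not> Y w)"

definition surrogate_score :: "(real \<Rightarrow> bool \<Rightarrow> real) \<Rightarrow> real \<Rightarrow> real \<Rightarrow> real \<Rightarrow> bool \<Rightarrow> real" where
  "surrogate_score S em ep q b =
    (if b then ((1 - em) * S q True - ep * S q False) / (1 - ep - em)
     else ((1 - ep) * S q False - em * S q True) / (1 - ep - em))"

text \<open>\<open>(p', em, ep)\<close> solves the principal's three equations and agrees with the known bit \<open>hi\<close>,
  the truth value of \<open>p > 1/2\<close>.\<close>

definition ssr_solution :: "real \<Rightarrow> real \<Rightarrow> real \<Rightarrow> bool \<Rightarrow> real \<times> real \<times> real \<Rightarrow> bool" where
  "ssr_solution \<alpha> \<beta> \<gamma> hi = (\<lambda>(p', em, ep).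
      \<alpha> = p' * (1 - ep) + (1 - p') * em
    \<and> \<beta> = p' * (1 - ep)^2 + (1 - p') * em^2
    \<and> \<gamma> = p' * (1 - ep)^3 + (1 - p') * em^3
    \<and> (p' > 1/2 \<longleftrightarrow> hi))"

text \<open>The payment depends only on what the principal knows. The uninformative case is recognised by
  \<open>\<beta> = \<alpha>\<^sup>2\<close>, in which the equations do not determine the error rates.\<close>

definition ssr_payment ::
  "(real \<Rightarrow> bool \<Rightarrow> real) \<Rightarrow> real \<Rightarrow> real \<Rightarrow> real \<Rightarrow> bool \<Rightarrow> real \<Rightarrow> bool \<Rightarrow> real" where
  "ssr_payment S \<alpha> \<beta> \<gamma> hi q b =
    (if \<beta> = \<alpha>^2 then 0
     else (case (THE t. ssr_solution \<alpha> \<beta> \<gamma> hi t) of (p', em, ep) \<Rightarrow> surrogate_score S em ep q b))"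

end

theory Submission
  imports Defs
begin

text \<open>
  Given \<open>y k\<close>, the pairs (signal, prediction signal) of different agents are independent. Averaging
  over peers and passing to the limit, the reference report is independent of agent \<open>i\<close>'s signal
  given \<open>y k\<close>; averaging over triples of distinct peers, among which coinciding triples are
  negligible, \<open>z1, z2, z3\<close> are conditionally i.i.d. with the law of \<open>z\<close>. Hence \<open>\<alpha>, \<beta>, \<gamma>\<close> are the
  first three moments of the two-point law with mass \<open>p\<close> at \<open>1 - ep\<close> and \<open>1 - p\<close> at \<open>em\<close>. If
  \<open>1 - ep \<noteq> em\<close>, these moments determine the law, so a solution is unique up to exchanging the two
  atoms, and since \<open>p \<noteq> 1/2\<close> the bit \<open>p > 1/2\<close> excludes the exchange. The surrogate score built from
  the true error rates inverts the noise channel from \<open>y k\<close> to \<open>z\<close>, so it is unbiased under any law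
  for which these are the error rates; by conditional independence this includes the law
  conditioned on agent \<open>i\<close>'s signal.
\<close>

section \<open>Recovering the error rates from three moments\<close>

lemma two_point_moments_unique:
  fixes p a e p' a' e' :: real
  assumes "0 < p" "p < 1" "a \<noteq> e"
    and m1: "p' * a' + (1 - p') * e' = p * a + (1 - p) * e"
    and m2: "p' * a'^2 + (1 - p') * e'^2 = p * a^2 + (1 - p) * e^2"
    and m3: "p' * a'^3 + (1 - p') * e'^3 = p * a^3 + (1 - p) * e^3"
  shows "p' = p \<and> a' = a \<and> e' = e \<or> p' = 1 - p \<and> a' = e \<and> e' = a"
proof -
  define \<alpha> \<beta> \<gamma> where "\<alpha> = p * a + (1 - p) * e" and "\<beta> = p * a^2 + (1 - p) * e^2"
    and "\<gamma> = p * a^3 + (1 - p) * e^3"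
  have "\<beta> - \<alpha>^2 = p * (1 - p) * (a - e)^2"
    unfolding \<alpha>_def \<beta>_def by algebra
  then have var: "\<beta> - \<alpha>^2 \<noteq> 0"
    using assms by simp
  \<comment> \<open>The atoms are the roots of a monic quadratic whose coefficients solve a linear system in the
    moments; its determinant is the variance.\<close>
  have "(\<beta> - \<alpha>^2) * (a + e) = \<gamma> - \<alpha> * \<beta>" "(\<beta> - \<alpha>^2) * (a * e) = \<alpha> * \<gamma> - \<beta>^2"
    unfolding \<alpha>_def \<beta>_def \<gamma>_def by algebra+
  moreover have "(\<beta> - \<alpha>^2) * (a' + e') = \<gamma> - \<alpha> * \<beta>" "(\<beta> - \<alpha>^2) * (a' * e') = \<alpha> * \<gamma> - \<beta>^2"
    unfolding \<alpha>_def \<beta>_def \<gamma>_def m1[symmetric] m2[symmetric] m3[symmetric] by algebra+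
  ultimately have sum: "a' + e' = a + e" and prod: "a' * e' = a * e"
    using var by (metis mult_left_cancel)+
  have "(a' - a) * (a' - e) = 0"
    using sum prod by algebra
  then consider "a' = a" "e' = e" | "a' = e" "e' = a"
    using sum by auto
  then show ?thesis
  proof cases
    case 1
    then have "(p' - p) * (a - e) = 0" using m1 unfolding 1 by (simp add: algebra_simps)
    then show ?thesis using 1 assms(3) by simp
  next
    case 2
    then have "(p' - (1 - p)) * (e - a) = 0" using m1 unfolding 2 by (simp add: algebra_simps)
    then show ?thesis using 2 assms(3) by simp
  qed
qed

lemma the_ssr_solution:
  assumes p: "0 < p" "p < 1" "p \<noteq> 1/2" and inf: "ep + em \<noteq> 1"
    and sol: "ssr_solution \<alpha> \<beta> \<gamma> (p > 1/2) (p, em, ep)"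
  shows "(THE t. ssr_solution \<alpha> \<beta> \<gamma> (p > 1/2) t) = (p, em, ep)"
proof (rule the_equality)
  show "ssr_solution \<alpha> \<beta> \<gamma> (p > 1/2) (p, em, ep)" by (rule sol)
  fix t
  assume t: "ssr_solution \<alpha> \<beta> \<gamma> (p > 1/2) t"
  obtain p' em' ep' where t_eq: "t = (p', em', ep')" by (cases t)
  have "p' = p \<and> 1 - ep' = 1 - ep \<and> em' = em \<or> p' = 1 - p \<and> 1 - ep' = em \<and> em' = 1 - ep"
    using p inf sol t unfolding ssr_solution_def t_eq
    by (intro two_point_moments_unique) auto
  \<comment> \<open>The bit puts \<open>p'\<close> above 1/2 exactly when \<open>p\<close> is,
    whereas \<open>1 - p\<close> is above 1/2 exactly when \<open>p\<close> is not, since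
    \<open>p \<noteq> 1/2\<close>.\<close>
  moreover have "p' \<noteq> 1 - p"
    using t p unfolding ssr_solution_def t_eq by auto
  ultimately show "t = (p, em, ep)"
    by (auto simp: t_eq)
qed

lemma ssr_payment_eq_surrogate_score:
  assumes p: "0 < p" "p < 1" "p \<noteq> 1/2" and inf: "ep + em \<noteq> 1"
    and sol: "ssr_solution \<alpha> \<beta> \<gamma> (p > 1/2) (p, em, ep)"
  shows "ssr_payment S \<alpha> \<beta> \<gamma> (p > 1/2) q b = surrogate_score S em ep q b"
proof -
  \<comment> \<open>The left side is the variance of the two-point law. It vanishes only in the
    uninformative case, so the default payment 0 is not taken.\<close>
  have "p * (1 - ep)^2 + (1 - p) * em^2 - (p * (1 - ep) + (1 - p) * em)^2 = p * (1 - p) * (1 - ep - em)^2"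
    by algebra
  then have "\<beta> - \<alpha>^2 = p * (1 - p) * (1 - ep - em)^2"
    using sol by (simp add: ssr_solution_def)
  then have "\<beta> \<noteq> \<alpha>^2"
    using p inf by auto
  then show ?thesis
    unfolding ssr_payment_def the_ssr_solution[OF assms] by simp
qed

section \<open>Unbiasedness of the surrogate score\<close>

lemma (in prob_space) expectation_bool_valued:
  fixes g :: "bool \<Rightarrow> real"
  assumes [measurable]: "Measurable.pred M Z"
  shows "(LINT w|M. g (Z w)) = \<P>(w in M. Z w) * g True + \<P>(w in M. \<not> Z w) * g False"
proof -
  have "(LINT w|M. g (Z w)) =
      (LINT w|M. indicator {w \<in> space M. Z w} w * g True + indicator {w \<in> space M. \<not> Z w} w * g False)"
    by (intro Bochner_Integration.integral_cong) (auto simp: indicator_def)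
  also have "\<dots> = \<P>(w in M. Z w) * g True + \<P>(w in M. \<not> Z w) * g False"
  proof -
    have "integrable M (\<lambda>w. indicator {w \<in> space M. Z w} w * g True)"
      "integrable M (\<lambda>w. indicator {w \<in> space M. \<not> Z w} w * g False)"
      by (intro integrable_mult_left integrable_real_indicator; simp add: less_top[symmetric])+
    then show ?thesis by simp
  qed
  finally show ?thesis .
qed

lemma (in prob_space) prob_split_bool:
  assumes [measurable]: "Measurable.pred M P" "Measurable.pred M Z"
  shows "\<P>(w in M. P w) = \<P>(w in M. P w \<and> Z w) + \<P>(w in M. P w \<and> \<not> Z w)"
  by (subst finite_measure_Union[symmetric]) (auto intro!: arg_cong[where f=prob])

text \<open>The surrogate score applies the inverse of the channel matrix, whose determinant is
  \<open>1 - ep - em\<close>, to the pair \<open>S q True\<close>, \<open>S q False\<close>. The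
  rates enter through products, not conditional probabilities, so that laws under which
  \<open>Y\<close> is almost surely constant are covered.\<close>

lemma (in prob_space) expectation_surrogate_score:
  assumes [measurable]: "Measurable.pred M Y" "Measurable.pred M Z"
    and inf: "ep + em \<noteq> 1"
    and pos: "\<P>(w in M. Y w \<and> Z w) = \<P>(w in M. Y w) * (1 - ep)"
    and neg: "\<P>(w in M. \<not> Y w \<and> Z w) = \<P>(w in M. \<not> Y w) * em"
  shows "(LINT w|M. surrogate_score S em ep q (Z w)) = (LINT w|M. S q (Y w))"
proof -
  let ?a = "\<P>(w in M. Y w)" and ?b = "\<P>(w in M. \<not> Y w)"
  let ?d = "1 - ep - em" and ?S1 = "S q True" and ?S0 = "S q False"
  have "\<P>(w in M. Z w) = \<P>(w in M. Y w \<and> Z w) + \<P>(w in M. \<not> Y w \<and> Z w)"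
    using prob_split_bool[of Z Y] by (simp add: conj_commute)
  then have Z: "\<P>(w in M. Z w) = ?a * (1 - ep) + ?b * em"
    using pos neg by simp
  have "\<P>(w in M. \<not> Z w) = \<P>(w in M. Y w \<and> \<not> Z w) + \<P>(w in M. \<not> Y w \<and> \<not> Z w)"
    using prob_split_bool[of "\<lambda>w. \<not> Z w" Y] by (simp add: conj_commute)
  moreover have "?a = \<P>(w in M. Y w \<and> Z w) + \<P>(w in M. Y w \<and> \<not> Z w)"
    by (rule prob_split_bool) measurable
  moreover have "?b = \<P>(w in M. \<not> Y w \<and> Z w) + \<P>(w in M. \<not> Y w \<and> \<not> Z w)"
    by (rule prob_split_bool) measurable
  ultimately have nZ: "\<P>(w in M. \<not> Z w) = ?a * ep + ?b * (1 - em)"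
    using pos neg by (simp add: algebra_simps)
  have d: "?d \<noteq> 0" using inf by auto
  have "(LINT w|M. surrogate_score S em ep q (Z w))
      = ((?a * (1 - ep) + ?b * em) * ((1 - em) * ?S1 - ep * ?S0)
        + (?a * ep + ?b * (1 - em)) * ((1 - ep) * ?S0 - em * ?S1)) / ?d"
    unfolding expectation_bool_valued[OF assms(2)] Z nZ
    by (simp add: surrogate_score_def add_divide_distrib)
  \<comment> \<open>In the coefficient of \<open>?S1\<close> the terms in \<open>?b\<close> cancel
    and those in \<open>?a\<close> leave \<open>?a * ?d\<close>; for \<open>?S0\<close> the roles of
    \<open>?a\<close> and \<open>?b\<close> are exchanged.\<close>
  also have "\<dots> = (?d * (?a * ?S1 + ?b * ?S0)) / ?d"
    by (intro arg_cong2[where f="(/)"] refl) algebra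
  also have "\<dots> = (LINT w|M. S q (Y w))"
    unfolding expectation_bool_valued[OF assms(1)] using d by simp
  finally show ?thesis .
qed

section \<open>Means over triples of distinct elements\<close>

text \<open>A triple with a coincidence is given by two elements and the two positions that agree;
  the three choices of positions yield the three maps and the factor 3.\<close>

lemma card_nondistinct_triples_le:
  assumes "finite P"
  shows "card (P \<times> P \<times> P - {(j1, j2, j3). j1 \<noteq> j2 \<and> j1 \<noteq> j3 \<and> j2 \<noteq> j3}) \<le> 3 * card P ^ 2"
proof -
  let ?f = "(\<lambda>(a, b). (a, a, b))" and ?g = "(\<lambda>(a, b). (a, b, a))" and ?h = "(\<lambda>(a, b). (b, a, a))"
  have "card (P \<times> P \<times> P - {(j1, j2, j3). j1 \<noteq> j2 \<and> j1 \<noteq> j3 \<and> j2 \<noteq> j3})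
      \<le> card (?f ` (P \<times> P) \<union> ?g ` (P \<times> P) \<union> ?h ` (P \<times> P))"
    using assms by (intro card_mono) (auto simp: image_iff)
  also have "\<dots> \<le> card (?f ` (P \<times> P)) + card (?g ` (P \<times> P)) + card (?h ` (P \<times> P))"
    by (meson add_mono card_Un_le le_refl order_trans)
  also have "\<dots> \<le> card (P \<times> P) + card (P \<times> P) + card (P \<times> P)"
    using assms by (intro add_mono card_image_le) auto
  finally show ?thesis
    by (simp add: power2_eq_square card_cartesian_product)
qed

text \<open>Over all triples the sum factors into three sums. With \<open>n\<close> the size of
  \<open>P N\<close>, triples with a coincidence contribute at most \<open>3 * n^2\<close>, the
  factors being bounded by 1, and this vanishes after division by \<open>n^3\<close>.\<close>

lemma sum_distinct_triples_tendsto: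
  fixes f g h :: "'a \<Rightarrow> real" and P :: "nat \<Rightarrow> 'a set"
  assumes fin: "\<And>N. finite (P N)" and card: "filterlim (\<lambda>N. card (P N)) at_top sequentially"
    and bnd: "\<And>x. \<bar>f x\<bar> \<le> 1" "\<And>x. \<bar>g x\<bar> \<le> 1" "\<And>x. \<bar>h x\<bar> \<le> 1"
    and lim: "(\<lambda>N. sum f (P N) / card (P N)) \<longlonglongrightarrow> a" "(\<lambda>N. sum g (P N) / card (P N)) \<longlonglongrightarrow> b"
      "(\<lambda>N. sum h (P N) / card (P N)) \<longlonglongrightarrow> c"
  shows "(\<lambda>N. (\<Sum>(j1, j2, j3)\<in>P N \<times> P N \<times> P N \<inter> {(j1, j2, j3). j1 \<noteq> j2 \<and> j1 \<noteq> j3 \<and> j2 \<noteq> j3}.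
                f j1 * g j2 * h j3) / real (card (P N)) ^ 3) \<longlonglongrightarrow> a * b * c"
proof -
  let ?D = "{(j1, j2, j3). j1 \<noteq> j2 \<and> j1 \<noteq> j3 \<and> j2 \<noteq> (j3::'a)}"
  let ?F = "\<lambda>(j1, j2, j3). f j1 * g j2 * h j3"
  let ?n = "\<lambda>N. real (card (P N))"
  let ?err = "\<lambda>N. sum ?F (P N \<times> P N \<times> P N - ?D) / ?n N ^ 3"
  have split: "sum ?F (P N \<times> P N \<times> P N \<inter> ?D) / ?n N ^ 3
      = (sum f (P N) / ?n N) * (sum g (P N) / ?n N) * (sum h (P N) / ?n N) - ?err N" for N
  proof -
    have "sum ?F (P N \<times> P N \<times> P N) = (\<Sum>j1\<in>P N. \<Sum>j2\<in>P N. \<Sum>j3\<in>P N. f j1 * (g j2 * h j3))"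
      by (simp add: sum.cartesian_product mult.assoc)
    also have "\<dots> = sum f (P N) * sum g (P N) * sum h (P N)"
      by (simp only: sum_distrib_left[symmetric] sum_distrib_right[symmetric] mult.assoc)
    finally have "sum ?F (P N \<times> P N \<times> P N) = sum f (P N) * sum g (P N) * sum h (P N)" .
    moreover have "sum ?F (P N \<times> P N \<times> P N)
        = sum ?F (P N \<times> P N \<times> P N \<inter> ?D) + sum ?F (P N \<times> P N \<times> P N - ?D)"
      using fin by (intro sum.Int_Diff) auto
    ultimately show ?thesis
      by (simp add: power3_eq_cube diff_divide_distrib[symmetric])
  qed
  have bound: "norm (?err N) \<le> 3 / ?n N" for N
  proof -
    have "\<bar>sum ?F (P N \<times> P N \<times> P N - ?D)\<bar> \<le> (\<Sum>t\<in>P N \<times> P N \<times> P N - ?D. \<bar>?F t\<bar>)"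
      by (rule sum_abs)
    also have "\<dots> \<le> real (card (P N \<times> P N \<times> P N - ?D)) * 1"
      using bnd by (intro sum_bounded_above) (auto simp: abs_mult intro!: mult_le_one)
    also have "\<dots> \<le> 3 * ?n N ^ 2"
      using of_nat_mono[OF card_nondistinct_triples_le[OF fin, of N], where 'a=real] by simp
    finally have "norm (?err N) \<le> 3 * ?n N ^ 2 / ?n N ^ 3"
      by (simp add: divide_right_mono)
    \<comment> \<open>For \<open>?n N = 0\<close> both sides are 0 by the convention for division by
      zero.\<close>
    then show ?thesis
      by (cases "?n N = 0") (simp_all add: power2_eq_square power3_eq_cube)
  qed
  have "filterlim ?n at_top sequentially"
    by (rule filterlim_compose[OF filterlim_real_sequentially card])
  then have "(\<lambda>N. 3 / ?n N) \<longlonglongrightarrow> 0"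
    by (intro tendsto_divide_0[OF tendsto_const] filterlim_at_top_imp_at_infinity)
  then have "?err \<longlonglongrightarrow> 0"
    by (rule Lim_null_comparison[OF always_eventually, rule_format, OF bound])
  then have "(\<lambda>N. (sum f (P N) / ?n N) * (sum g (P N) / ?n N) * (sum h (P N) / ?n N) - ?err N)
      \<longlonglongrightarrow> a * b * c - 0"
    using lim by (intro tendsto_intros)
  then show ?thesis
    by (simp only: split[symmetric] diff_0_right)
qed

text \<open>The mean divides by the number of distinct triples,
  \<open>sum_distinct_triples_tendsto\<close> by \<open>n^3\<close>. That lemma for three functions
  constantly 1 shows that the ratio of the two normalizations tends to 1.\<close>

lemma mean_distinct_triples_tendsto:
  fixes f g h :: "'a \<Rightarrow> real" and P :: "nat \<Rightarrow> 'a set"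
  assumes fin: "\<And>N. finite (P N)" and card: "filterlim (\<lambda>N. card (P N)) at_top sequentially"
    and bnd: "\<And>x. \<bar>f x\<bar> \<le> 1" "\<And>x. \<bar>g x\<bar> \<le> 1" "\<And>x. \<bar>h x\<bar> \<le> 1"
    and lim: "(\<lambda>N. sum f (P N) / card (P N)) \<longlonglongrightarrow> a" "(\<lambda>N. sum g (P N) / card (P N)) \<longlonglongrightarrow> b"
      "(\<lambda>N. sum h (P N) / card (P N)) \<longlonglongrightarrow> c"
    and T: "\<And>N. T N = P N \<times> P N \<times> P N \<inter> {(j1, j2, j3). j1 \<noteq> j2 \<and> j1 \<noteq> j3 \<and> j2 \<noteq> j3}"
  shows "(\<lambda>N. measure_pmf.expectation (pmf_of_set (T N)) (\<lambda>(j1, j2, j3). f j1 * g j2 * h j3))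
    \<longlonglongrightarrow> a * b * c"
proof -
  let ?F = "\<lambda>(j1, j2, j3). f j1 * g j2 * h j3"
  let ?n = "\<lambda>N. real (card (P N))"
  have n_pos: "\<forall>\<^sub>F N in sequentially. card (P N) > 0"
    using card unfolding filterlim_at_top by (auto elim!: eventually_mono dest!: spec[of _ 1])
  have one: "(\<lambda>N. (\<Sum>j\<in>P N. 1) / ?n N) \<longlonglongrightarrow> 1"
    by (rule tendsto_eventually, use n_pos in eventually_elim) simp
  have "(\<lambda>N. (\<Sum>(j1, j2, j3)\<in>T N. 1 * 1 * 1) / ?n N ^ 3) \<longlonglongrightarrow> 1 * 1 * 1"
    unfolding T
    using sum_distinct_triples_tendsto[of P "\<lambda>_. 1" "\<lambda>_. 1" "\<lambda>_. 1", OF fin card _ _ _ one one one]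
    by simp
  then have card_T: "(\<lambda>N. card (T N) / ?n N ^ 3) \<longlonglongrightarrow> 1"
    by (simp add: split_def)
  have "(\<lambda>N. (sum ?F (T N) / ?n N ^ 3) / (card (T N) / ?n N ^ 3)) \<longlonglongrightarrow> a * b * c / 1"
    by (rule tendsto_divide[OF _ card_T])
      (use sum_distinct_triples_tendsto[OF fin card bnd lim] in \<open>simp_all add: T\<close>)
  \<comment> \<open>A sequence with positive limit is eventually positive, so \<open>T N\<close> is
    eventually nonempty and \<open>pmf_of_set\<close> is the uniform law on it.\<close>
  moreover have "\<forall>\<^sub>F N in sequentially. card (T N) / ?n N ^ 3 > 0"
    using card_T by (rule order_tendstoD) simp
  then have "\<forall>\<^sub>F N in sequentially. (sum ?F (T N) / ?n N ^ 3) / (card (T N) / ?n N ^ 3)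
      = measure_pmf.expectation (pmf_of_set (T N)) ?F"
  proof (eventually_elim)
    case (elim N)
    then have "T N \<noteq> {}" "?n N \<noteq> 0" by (auto simp: zero_less_divide_iff)
    moreover have "finite (T N)" by (simp add: T fin)
    ultimately show ?case
      by (simp add: integral_pmf_of_set)
  qed
  ultimately show ?thesis
    by (simp add: tendsto_cong)
qed

section \<open>Independence of finite-valued variables\<close>

text \<open>An event about finitely many finite-valued variables is a finite disjoint union of point
  events, so factorization at points carries over by expanding a product of sums.\<close>

lemma (in prob_space) indep_vars_finite_valuedI:
  fixes X :: "'i \<Rightarrow> 'a \<Rightarrow> 'b"
  assumes fin: "\<And>j. j \<in> I \<Longrightarrow> finite (V j)"
    and X: "\<And>j. j \<in> I \<Longrightarrow> X j \<in> measurable M (count_space (V j))"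
    and point: "\<And>J x. finite J \<Longrightarrow> J \<noteq> {} \<Longrightarrow> J \<subseteq> I \<Longrightarrow> (\<And>j. j \<in> J \<Longrightarrow> x j \<in> V j) \<Longrightarrow>
      \<P>(w in M. \<forall>j\<in>J. X j w = x j) = (\<Prod>j\<in>J. \<P>(w in M. X j w = x j))"
  shows "indep_vars (\<lambda>j. count_space (V j)) X I"
  unfolding indep_vars_def2
proof (intro conjI ballI indep_setsI)
  fix j assume "j \<in> I"
  then show "X j \<in> measurable M (count_space (V j))" by (rule X)
next
  fix j assume "j \<in> I"
  then show "{X j -` B \<inter> space M |B. B \<in> sets (count_space (V j))} \<subseteq> events"
    using measurable_sets[OF X] by auto
next
  fix A J
  assume J: "J \<noteq> {}" "J \<subseteq> I" "finite J"
    and A: "\<forall>j\<in>J. A j \<in> {X j -` B \<inter> space M |B. B \<in> sets (count_space (V j))}"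
  have "\<exists>B. B \<subseteq> V j \<and> A j = X j -` B \<inter> space M" if "j \<in> J" for j
    using bspec[OF A that] by auto
  then obtain B where B: "\<And>j. j \<in> J \<Longrightarrow> B j \<subseteq> V j" "\<And>j. j \<in> J \<Longrightarrow> A j = X j -` B j \<inter> space M"
    by metis
  have fin_B: "finite (B j)" if "j \<in> J" for j
    using that B(1) fin J(2) by (meson finite_subset subsetD)
  have X_eq: "{w \<in> space M. X j w = v} \<in> events" if "j \<in> J" "v \<in> V j" for j v
  proof -
    have "X j -` {v} \<inter> space M \<in> events"
      using that J(2) by (intro measurable_sets[OF X]) auto
    also have "X j -` {v} \<inter> space M = {w \<in> space M. X j w = v}" by auto
    finally show ?thesis .
  qed
  have marginal: "prob (A j) = (\<Sum>v\<in>B j. \<P>(w in M. X j w = v))" if "j \<in> J" for j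
  proof -
    have "A j = (\<Union>v\<in>B j. {w \<in> space M. X j w = v})"
      using B(2)[OF that] by auto
    also have "prob \<dots> = (\<Sum>v\<in>B j. \<P>(w in M. X j w = v))"
      using X_eq B(1) that
      by (intro finite_measure_finite_Union fin_B that) (auto simp: disjoint_family_on_def)
    finally show ?thesis .
  qed
  have "(\<Inter>j\<in>J. A j) = (\<Union>x\<in>PiE J B. {w \<in> space M. \<forall>j\<in>J. X j w = x j})"
  proof (intro equalityI subsetI)
    fix w assume w: "w \<in> (\<Inter>j\<in>J. A j)"
    then have "w \<in> space M" using J(1) B(2) by fastforce
    \<comment> \<open>The witness is restricted to \<open>J\<close> because members of
      \<open>PiE J B\<close> are \<open>undefined\<close> elsewhere.\<close>
    then show "w \<in> (\<Union>x\<in>PiE J B. {w \<in> space M. \<forall>j\<in>J. X j w = x j})"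
      using w B(2) by (intro UN_I[of "restrict (\<lambda>j. X j w) J"]) (auto simp del: INT_simps)
  next
    fix w assume "w \<in> (\<Union>x\<in>PiE J B. {w \<in> space M. \<forall>j\<in>J. X j w = x j})"
    then show "w \<in> (\<Inter>j\<in>J. A j)" using B(2) by (auto simp: PiE_iff)
  qed
  also have "prob \<dots> = (\<Sum>x\<in>PiE J B. \<P>(w in M. \<forall>j\<in>J. X j w = x j))"
  proof (rule finite_measure_finite_Union)
    show "finite (PiE J B)" using J(3) fin_B by (rule finite_PiE)
    show "(\<lambda>x. {w \<in> space M. \<forall>j\<in>J. X j w = x j}) ` PiE J B \<subseteq> events"
    proof safe
      fix x assume x: "x \<in> PiE J B"
      have "{w \<in> space M. X j w = x j} \<in> events" if "j \<in> J" for j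
        using that x B(1) by (intro X_eq) (auto simp: PiE_iff)
      then show "{w \<in> space M. \<forall>j\<in>J. X j w = x j} \<in> events"
        using J(3) by (intro sets.sets_Collect_finite_All') (auto simp: J(1))
    qed
    show "disjoint_family_on (\<lambda>x. {w \<in> space M. \<forall>j\<in>J. X j w = x j}) (PiE J B)"
      unfolding disjoint_family_on_def
    proof safe
      fix x x' w assume *: "x \<in> PiE J B" "x' \<in> PiE J B" "x \<noteq> x'" "\<forall>j\<in>J. X j w = x j" "\<forall>j\<in>J. X j w = x' j"
      have "x = x'" by (rule PiE_ext[OF *(1,2)]) (use * in auto)
      with * show "w \<in> {}" by simp
    qed
  qed
  also have "\<dots> = (\<Sum>x\<in>PiE J B. \<Prod>j\<in>J. \<P>(w in M. X j w = x j))"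
    using J B(1) by (intro sum.cong point) (auto simp: PiE_iff)
  also have "\<dots> = (\<Prod>j\<in>J. \<Sum>v\<in>B j. \<P>(w in M. X j w = v))"
    by (rule prod_sum_PiE[OF J(3) fin_B, symmetric])
  also have "\<dots> = (\<Prod>j\<in>J. prob (A j))"
    by (rule prod.cong) (simp_all add: marginal)
  finally show "prob (\<Inter>j\<in>J. A j) = (\<Prod>j\<in>J. prob (A j))" .
qed

text \<open>Every subset of \<open>V j\<close> is measurable in the counting space, so arbitrary
  predicates can take the place of measurable sets; cutting them down to \<open>V j\<close> changes
  nothing, as \<open>X j\<close> takes its values there.\<close>

lemma (in prob_space) indep_vars_countD:
  assumes X: "indep_vars (\<lambda>j. count_space (V j)) X I"
    and J: "finite J" "J \<noteq> {}" "J \<subseteq> I"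
  shows "\<P>(w in M. \<forall>j\<in>J. Q j (X j w)) = (\<Prod>j\<in>J. \<P>(w in M. Q j (X j w)))"
proof -
  have eq: "X j -` {x \<in> V j. Q j x} \<inter> space M = {w \<in> space M. Q j (X j w)}" if "j \<in> J" for j
  proof -
    have "X j \<in> measurable M (count_space (V j))"
      using X J(3) that by (auto simp: indep_vars_def)
    then have "X j w \<in> V j" if "w \<in> space M" for w
      using measurable_space[of "X j" M "count_space (V j)" w] that by simp
    then show ?thesis by auto
  qed
  have "{w \<in> space M. \<forall>j\<in>J. Q j (X j w)} = (\<Inter>j\<in>J. {w \<in> space M. Q j (X j w)})"
    using J(2) by auto
  also have "\<dots> = (\<Inter>j\<in>J. X j -` {x \<in> V j. Q j x} \<inter> space M)"
    by (intro INF_cong refl eq[symmetric])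
  also have "prob \<dots> = (\<Prod>j\<in>J. prob (X j -` {x \<in> V j. Q j x} \<inter> space M))"
    by (rule indep_varsD[OF X J(2,1,3)]) auto
  also have "\<dots> = (\<Prod>j\<in>J. \<P>(w in M. Q j (X j w)))"
    by (intro prod.cong refl arg_cong[where f=prob] eq)
  finally show ?thesis .
qed

section \<open>Random peers as their number grows\<close>

lemma finite_peers: "finite (peers N i)"
  by (simp add: peers_def)

lemma card_peers_at_top: "filterlim (\<lambda>N. card (peers N i)) at_top sequentially"
proof (rule filterlim_at_top_mono)
  show "filterlim (\<lambda>N. N - 1) at_top sequentially"
    by (rule filterlim_minus_const_nat_at_top)
  show "\<forall>\<^sub>F N in sequentially. N - 1 \<le> card (peers N i)"
    by (rule always_eventually) (auto simp: peers_def card_Diff_singleton_if)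
qed

text \<open>For small \<open>N\<close> the set of peers can be empty, where
  \<open>pmf_of_set\<close> is no uniform law; hence the identity is asserted only
  eventually.\<close>

lemma expectation_peers:
  "\<forall>\<^sub>F N in sequentially. measure_pmf.expectation (pmf_of_set (peers N i)) f
      = (\<Sum>j\<in>peers N i. f j) / card (peers N i)"
proof -
  have "\<forall>\<^sub>F N in sequentially. card (peers N i) \<ge> 1"
    using card_peers_at_top unfolding filterlim_at_top by blast
  then show ?thesis
  proof eventually_elim
    case (elim N)
    then have "peers N i \<noteq> {}" by auto
    then show ?case by (simp add: integral_pmf_of_set finite_peers)
  qed
qed

section \<open>Laws conditioned on the ground truth\<close>

context elicitation
begin

declare s_measurable [measurable]

lemma observations_measurable:
  "(\<lambda>w. (\<lambda>j. obs j k w, y k w)) \<in> M \<rightarrow>\<^sub>M (\<Pi>\<^sub>M j\<in>UNIV. count_space (Sig j)) \<Otimes>\<^sub>M count_space UNIV"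
  using tasks_indep unfolding indep_vars_def by auto

lemma y_measurable [measurable]: "y k \<in> M \<rightarrow>\<^sub>M count_space UNIV"
  using measurable_compose[OF observations_measurable measurable_snd] by simp

lemma obs_measurable: "obs j k \<in> M \<rightarrow>\<^sub>M count_space (Sig j)"
proof -
  have "(\<lambda>w j. obs j k w) \<in> M \<rightarrow>\<^sub>M (\<Pi>\<^sub>M j\<in>UNIV. count_space (Sig j))"
    using measurable_compose[OF observations_measurable measurable_fst] by simp
  from measurable_compose[OF this measurable_component_singleton[of j]] show ?thesis by simp
qed

lemma obs_in_Sig: "w \<in> space M \<Longrightarrow> obs j k w \<in> Sig j"
  using measurable_space[OF obs_measurable] by auto

lemma obs_eq_measurable [measurable]: "Measurable.pred M (\<lambda>w. obs j k w = v)"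
proof -
  have "Measurable.pred (count_space (Sig j)) (\<lambda>x. x = v)" by simp
  from measurable_compose[OF obs_measurable this] show ?thesis .
qed

lemma prob_y: "\<P>(w in M. y k w = b) = (if b then p else 1 - p)"
proof (cases b)
  case False
  have "\<P>(w in M. \<not> y k w) = 1 - \<P>(w in M. y k w)"
    by (rule prob_neg) simp
  then show ?thesis using False prior by simp
qed (simp add: prior)

lemma prob_y_pos: "\<P>(w in M. y k w = b) > 0"
  using prior_range by (simp add: prob_y)

text \<open>As a measure in its own right it turns independence given \<open>y k\<close> into
  ordinary independence, and it unfolds to the measure in \<open>signals_cond_indep\<close>.\<close>

definition cond_y :: "nat \<Rightarrow> bool \<Rightarrow> 'w measure" where
  "cond_y k b = uniform_measure M {w \<in> space M. y k w = b}"

lemma sets_cond_y [measurable_cong, simp]: "sets (cond_y k b) = sets M"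
  and space_cond_y [simp]: "space (cond_y k b) = space M"
  by (simp_all add: cond_y_def)

lemma prob_space_cond_y: "prob_space (cond_y k b)"
  unfolding cond_y_def
  using prob_y_pos[of k b] by (intro prob_space_uniform_measure) (auto simp: emeasure_eq_measure)

lemma prob_cond_y:
  assumes "Measurable.pred M Q"
  shows "\<P>(w in cond_y k b. Q w) = \<P>(w in M. Q w \<bar> y k w = b)"
  using measure_uniform_measure_eq_cond_prob[OF assms, of "\<lambda>w. y k w = b"] by (simp add: cond_y_def)

lemma prob_and_y:
  assumes "Measurable.pred M Q"
  shows "\<P>(w in M. y k w = b \<and> Q w) = \<P>(w in M. y k w = b) * \<P>(w in cond_y k b. Q w)"
  unfolding prob_cond_y[OF assms] using prob_y_pos[of k b] by (simp add: cond_prob_def conj_commute)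

lemma sum_prob_obs:
  assumes [measurable]: "Measurable.pred M Q"
  shows "(\<Sum>v\<in>Sig i. \<P>(w in cond_y k b. obs i k w = v \<and> Q w)) = \<P>(w in cond_y k b. Q w)"
proof -
  interpret C: prob_space "cond_y k b" by (rule prob_space_cond_y)
  have "(\<Sum>v\<in>Sig i. \<P>(w in cond_y k b. obs i k w = v \<and> Q w))
      = C.prob (\<Union>v\<in>Sig i. {w \<in> space (cond_y k b). obs i k w = v \<and> Q w})"
    by (rule C.finite_measure_finite_Union[symmetric]) (auto simp: disjoint_family_on_def finite_signals)
  also have "(\<Union>v\<in>Sig i. {w \<in> space (cond_y k b). obs i k w = v \<and> Q w}) = {w \<in> space (cond_y k b). Q w}"
    using obs_in_Sig by auto
  finally show ?thesis .
qed

text \<open>The factor of one agent and one task in \<open>reports\<close> when the report is left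
  free: the chance of prediction signal \<open>c\<close> after private signal
  \<open>v\<close>.\<close>

definition prediction_prob :: "nat \<Rightarrow> nat \<Rightarrow> 's \<Rightarrow> bool \<Rightarrow> real" where
  "prediction_prob j k v c
    = (LINT x:UNIV|\<sigma> j (posterior M (y k) (obs j k) v). pmf (bernoulli_pmf x) c)"

lemma cond_y_obs_indep:
  assumes "finite J" "J \<noteq> {}"
  shows "\<P>(w in cond_y k b. \<forall>j\<in>J. obs j k w = v j) = (\<Prod>j\<in>J. \<P>(w in cond_y k b. obs j k w = v j))"
proof -
  interpret C: prob_space "cond_y k b" by (rule prob_space_cond_y)
  show ?thesis
    using C.indep_vars_countD[OF signals_cond_indep[of k b, folded cond_y_def] assms,
        of "\<lambda>j x. x = v j"] by simp
qed

text \<open>This is \<open>reports\<close> for the single task \<open>k\<close> with unconstrained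
  reports, divided by the positive probability of \<open>y k = b\<close>. Each agent's factor
  involves only that agent's own signal.\<close>

lemma cond_y_obs_prediction:
  assumes J: "finite J" "J \<noteq> {}"
  shows "\<P>(w in cond_y k b. \<forall>j\<in>J. obs j k w = v j \<and> s j k w = c j)
    = (\<Prod>j\<in>J. \<P>(w in cond_y k b. obs j k w = v j) * prediction_prob j k (v j) (c j))"
proof -
  have [measurable]: "Measurable.pred M (\<lambda>w. \<forall>j\<in>J. obs j k w = v j)"
    "Measurable.pred M (\<lambda>w. \<forall>j\<in>J. obs j k w = v j \<and> s j k w = c j)"
    using J(1) by (auto intro!: pred_intros_finite)
  define E where "E = {w \<in> space M. \<forall>l\<in>{k}. y l w = b \<and> (\<forall>j\<in>J. obs j l w = v j)}"
  have "prob {w \<in> E. \<forall>j\<in>J. \<forall>l\<in>{k}. rpt j l w \<in> UNIV \<and> s j l w = c j}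
      = prob E * (\<Prod>j\<in>J. \<Prod>l\<in>{k}. prediction_prob j l (v j) (c j))"
    unfolding prediction_prob_def by (rule reports[OF J(1)]) (simp_all add: E_def)
  also have "{w \<in> E. \<forall>j\<in>J. \<forall>l\<in>{k}. rpt j l w \<in> UNIV \<and> s j l w = c j}
      = {w \<in> space M. y k w = b \<and> (\<forall>j\<in>J. obs j k w = v j \<and> s j k w = c j)}"
    by (auto simp: E_def)
  also have "prob \<dots> = \<P>(w in M. y k w = b) * \<P>(w in cond_y k b. \<forall>j\<in>J. obs j k w = v j \<and> s j k w = c j)"
    by (rule prob_and_y) fact
  also have "E = {w \<in> space M. y k w = b \<and> (\<forall>j\<in>J. obs j k w = v j)}"
    by (auto simp: E_def)
  also have "prob \<dots> = \<P>(w in M. y k w = b) * \<P>(w in cond_y k b. \<forall>j\<in>J. obs j k w = v j)"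
    by (rule prob_and_y) fact
  finally have "\<P>(w in M. y k w = b) * \<P>(w in cond_y k b. \<forall>j\<in>J. obs j k w = v j \<and> s j k w = c j)
      = \<P>(w in M. y k w = b) * (\<P>(w in cond_y k b. \<forall>j\<in>J. obs j k w = v j) * (\<Prod>j\<in>J. prediction_prob j k (v j) (c j)))"
    by (simp add: mult.assoc)
  then show ?thesis
    using prob_y_pos[of k b] cond_y_obs_indep[OF J, of k b v] by (simp add: prod.distrib)
qed

text \<open>By \<open>cond_y_obs_prediction\<close> the joint point probabilities are products of
  one-agent factors, and its instance for a single agent identifies each factor as a
  marginal.\<close>

lemma signal_pairs_cond_indep:
  "prob_space.indep_vars (cond_y k b) (\<lambda>j. count_space (Sig j \<times> UNIV)) (\<lambda>j w. (obs j k w, s j k w)) UNIV"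
proof -
  interpret C: prob_space "cond_y k b" by (rule prob_space_cond_y)
  show ?thesis
  proof (rule C.indep_vars_finite_valuedI)
    fix j show fin: "finite (Sig j \<times> (UNIV :: bool set))"
      by (simp add: finite_signals)
    show "(\<lambda>w. (obs j k w, s j k w)) \<in> cond_y k b \<rightarrow>\<^sub>M count_space (Sig j \<times> UNIV)"
    proof (subst measurable_count_space_eq2[OF fin], intro conjI ballI)
      show "(\<lambda>w. (obs j k w, s j k w)) \<in> space (cond_y k b) \<rightarrow> Sig j \<times> UNIV"
        by (auto simp: obs_in_Sig)
      fix x :: "'s \<times> bool"
      have "(\<lambda>w. (obs j k w, s j k w)) -` {x} \<inter> space (cond_y k b)
          = {w \<in> space M. obs j k w = fst x \<and> s j k w = snd x}" by (cases x) auto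
      then show "(\<lambda>w. (obs j k w, s j k w)) -` {x} \<inter> space (cond_y k b) \<in> sets (cond_y k b)"
        by simp
    qed
  next
    fix J :: "nat set" and x :: "nat \<Rightarrow> 's \<times> bool"
    assume J: "finite J" "J \<noteq> {}"
    have "C.prob {w \<in> space (cond_y k b). (obs j k w, s j k w) = x j}
        = \<P>(w in cond_y k b. obs j k w = fst (x j)) * prediction_prob j k (fst (x j)) (snd (x j))" for j
      using cond_y_obs_prediction[of "{j}" k b "\<lambda>j. fst (x j)" "\<lambda>j. snd (x j)"]
      by (simp add: prod_eq_iff)
    then show "C.prob {w \<in> space (cond_y k b). \<forall>j\<in>J. (obs j k w, s j k w) = x j}
        = (\<Prod>j\<in>J. C.prob {w \<in> space (cond_y k b). (obs j k w, s j k w) = x j})"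
      using cond_y_obs_prediction[OF J, of k b "\<lambda>j. fst (x j)" "\<lambda>j. snd (x j)"]
      by (simp add: prod_eq_iff)
  qed
qed

lemma signal_pairs_cond_prob:
  assumes "finite J" "J \<noteq> {}"
  shows "\<P>(w in cond_y k b. \<forall>j\<in>J. Q j (obs j k w, s j k w))
    = (\<Prod>j\<in>J. \<P>(w in cond_y k b. Q j (obs j k w, s j k w)))"
proof -
  interpret C: prob_space "cond_y k b" by (rule prob_space_cond_y)
  show ?thesis
    by (rule C.indep_vars_countD[OF signal_pairs_cond_indep assms]) simp
qed

lemma obs_indep_prediction:
  assumes "j \<noteq> i"
  shows "\<P>(w in cond_y k b. obs i k w = v \<and> s j k w = c)
    = \<P>(w in cond_y k b. obs i k w = v) * \<P>(w in cond_y k b. s j k w = c)"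
proof -
  \<comment> \<open>Each agent has its own predicate: \<open>i\<close> is tested on the private
    signal, \<open>j\<close> on the prediction signal.\<close>
  have "\<P>(w in cond_y k b. \<forall>l\<in>{i, j}. if l = i then obs l k w = v else s l k w = c)
      = (\<Prod>l\<in>{i, j}. \<P>(w in cond_y k b. if l = i then obs l k w = v else s l k w = c))"
    using signal_pairs_cond_prob[of "{i, j}" k b "\<lambda>l x. if l = i then fst x = v else snd x = c"]
    by (simp only: fst_conv snd_conv finite.intros) simp
  then show ?thesis
    using assms by simp
qed

lemma predictions_indep:
  assumes "j1 \<noteq> j2" "j1 \<noteq> j3" "j2 \<noteq> j3"
  shows "\<P>(w in cond_y k b. s j1 k w = c1 \<and> s j2 k w = c2 \<and> s j3 k w = c3)
    = \<P>(w in cond_y k b. s j1 k w = c1) * \<P>(w in cond_y k b. s j2 k w = c2) * \<P>(w in cond_y k b. s j3 k w = c3)"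
proof -
  \<comment> \<open>The three values become one function of the agent; distinctness of the agents
    lets it return each value at its own agent.\<close>
  define c where "c = (\<lambda>j. if j = j1 then c1 else if j = j2 then c2 else c3)"
  have c: "c j1 = c1" "c j2 = c2" "c j3 = c3"
    using assms by (simp_all add: c_def)
  have "\<P>(w in cond_y k b. \<forall>j\<in>{j1, j2, j3}. s j k w = c j)
      = (\<Prod>j\<in>{j1, j2, j3}. \<P>(w in cond_y k b. s j k w = c j))"
    using signal_pairs_cond_prob[of "{j1, j2, j3}" k b "\<lambda>j x. snd x = c j"] by simp
  then show ?thesis
    using assms by (simp add: c mult.assoc)
qed

end

section \<open>Reference reports as limits over peers\<close>

context asymptotic_elicitation
begin

declare z_measurable [measurable]

text \<open>Each term of \<open>z_limit\<close> factors because a peer differs from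
  \<open>i\<close>. The weight stays in the statement since a signal may have conditional
  probability 0; only the positive probability of \<open>y k = b\<close> is cancelled.\<close>

lemma mean_prediction_tendsto_weighted:
  "(\<lambda>N. \<P>(w in cond_y k b. obs i k w = v) * ((\<Sum>j\<in>peers N i. \<P>(w in cond_y k b. s j k w = c)) / card (peers N i)))
    \<longlonglongrightarrow> \<P>(w in cond_y k b. obs i k w = v \<and> z i k w = c)"
proof -
  let ?a = "\<P>(w in M. y k w = b)"
  have eq: "\<P>(w in M. obs i k w = v \<and> y k w = b \<and> s j k w = c)
      = ?a * (\<P>(w in cond_y k b. obs i k w = v) * \<P>(w in cond_y k b. s j k w = c))"
    if "j \<in> peers N i" for j N
  proof -
    have "\<P>(w in M. obs i k w = v \<and> y k w = b \<and> s j k w = c) = \<P>(w in M. y k w = b \<and> (obs i k w = v \<and> s j k w = c))"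
      by (intro arg_cong[where f=prob] Collect_cong) auto
    also have "\<dots> = ?a * \<P>(w in cond_y k b. obs i k w = v \<and> s j k w = c)"
      by (rule prob_and_y) measurable
    finally show ?thesis
      using that by (simp only: obs_indep_prediction peers_def Diff_iff singleton_iff not_False_eq_True)
  qed
  have "\<P>(w in M. obs i k w = v \<and> y k w = b \<and> z i k w = c) = \<P>(w in M. y k w = b \<and> (obs i k w = v \<and> z i k w = c))"
    by (intro arg_cong[where f=prob] Collect_cong) auto
  also have "\<dots> = ?a * \<P>(w in cond_y k b. obs i k w = v \<and> z i k w = c)"
    by (rule prob_and_y) measurable
  finally have lim: "(\<lambda>N. measure_pmf.expectation (pmf_of_set (peers N i))
      (\<lambda>j. \<P>(w in M. obs i k w = v \<and> y k w = b \<and> s j k w = c)))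
    \<longlonglongrightarrow> ?a * \<P>(w in cond_y k b. obs i k w = v \<and> z i k w = c)"
    using z_limit[of i k v b c] by simp
  have "(\<lambda>N. ?a * (\<P>(w in cond_y k b. obs i k w = v) * ((\<Sum>j\<in>peers N i. \<P>(w in cond_y k b. s j k w = c)) / card (peers N i))))
    \<longlonglongrightarrow> ?a * \<P>(w in cond_y k b. obs i k w = v \<and> z i k w = c)"
    by (rule Lim_transform_eventually[OF lim],
        use expectation_peers[of i "\<lambda>j. \<P>(w in M. obs i k w = v \<and> y k w = b \<and> s j k w = c)"] in eventually_elim)
      (simp add: eq sum_distrib_left)
  then show ?thesis
    using prob_y_pos[of k b] by (subst (asm) tendsto_mult_left_iff) auto
qed

text \<open>Summing the weighted limits over the finitely many signals removes the weights, whose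
  total is 1, without dividing by any of them.\<close>

lemma mean_prediction_tendsto:
  "(\<lambda>N. (\<Sum>j\<in>peers N i. \<P>(w in cond_y k b. s j k w = c)) / card (peers N i))
    \<longlonglongrightarrow> \<P>(w in cond_y k b. z i k w = c)"
proof -
  interpret C: prob_space "cond_y k b" by (rule prob_space_cond_y)
  have one: "(\<Sum>v\<in>Sig i. \<P>(w in cond_y k b. obs i k w = v)) = 1"
    using sum_prob_obs[where Q="\<lambda>_. True"] C.prob_space by simp
  have "(\<lambda>N. \<Sum>v\<in>Sig i. \<P>(w in cond_y k b. obs i k w = v) *
        ((\<Sum>j\<in>peers N i. \<P>(w in cond_y k b. s j k w = c)) / card (peers N i)))
    \<longlonglongrightarrow> (\<Sum>v\<in>Sig i. \<P>(w in cond_y k b. obs i k w = v \<and> z i k w = c))"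
    by (intro tendsto_sum mean_prediction_tendsto_weighted)
  then show ?thesis
    using sum_prob_obs[of "\<lambda>w. z i k w = c" k b i] z_measurable
    unfolding sum_distrib_right[symmetric] one by simp
qed

text \<open>Both sides are limits of the same sequence of weighted peer averages.\<close>

lemma reference_cond_indep:
  "\<P>(w in cond_y k b. obs i k w = v \<and> z i k w = c)
    = \<P>(w in cond_y k b. obs i k w = v) * \<P>(w in cond_y k b. z i k w = c)"
  by (rule LIMSEQ_unique[OF mean_prediction_tendsto_weighted])
    (intro tendsto_mult tendsto_const mean_prediction_tendsto)

text \<open>Distinct peers have conditionally independent prediction signals, so the mean in
  \<open>z123_limit\<close> is eventually a mean of products, which tends to the product of the
  three single-peer limits.\<close>

lemma triple_law:
  "\<P>(w in M. y k w = b \<and> z1 i k w = c1 \<and> z2 i k w = c2 \<and> z3 i k w = c3)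
    = \<P>(w in M. y k w = b) * (\<P>(w in cond_y k b. z i k w = c1) * \<P>(w in cond_y k b. z i k w = c2)
        * \<P>(w in cond_y k b. z i k w = c3))"
proof (rule LIMSEQ_unique[OF z123_limit])
  interpret C: prob_space "cond_y k b" by (rule prob_space_cond_y)
  let ?a = "\<P>(w in M. y k w = b)"
  let ?q = "\<lambda>c j. \<P>(w in cond_y k b. s j k w = c)"
  let ?T = "\<lambda>N. pmf_of_set (peer_triples N i)"
  have "(\<lambda>N. measure_pmf.expectation (?T N) (\<lambda>(j1, j2, j3). ?q c1 j1 * ?q c2 j2 * ?q c3 j3))
    \<longlonglongrightarrow> \<P>(w in cond_y k b. z i k w = c1) * \<P>(w in cond_y k b. z i k w = c2) * \<P>(w in cond_y k b. z i k w = c3)"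
    by (rule mean_distinct_triples_tendsto[OF finite_peers card_peers_at_top _ _ _
          mean_prediction_tendsto mean_prediction_tendsto mean_prediction_tendsto])
      (auto simp: peer_triples_def)
  then have lim: "(\<lambda>N. ?a * measure_pmf.expectation (?T N) (\<lambda>(j1, j2, j3). ?q c1 j1 * ?q c2 j2 * ?q c3 j3))
    \<longlonglongrightarrow> ?a * (\<P>(w in cond_y k b. z i k w = c1) * \<P>(w in cond_y k b. z i k w = c2) * \<P>(w in cond_y k b. z i k w = c3))"
    by (rule tendsto_mult_left)
  \<comment> \<open>Three peers make the set of distinct triples nonempty, as averaging with
    \<open>pmf_of_set\<close> requires.\<close>
  have "\<forall>\<^sub>F N in sequentially. card (peers N i) \<ge> 3"
    using card_peers_at_top unfolding filterlim_at_top by blast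
  then have "\<forall>\<^sub>F N in sequentially.
      ?a * measure_pmf.expectation (?T N) (\<lambda>(j1, j2, j3). ?q c1 j1 * ?q c2 j2 * ?q c3 j3)
    = measure_pmf.expectation (?T N)
       (\<lambda>(j1, j2, j3). \<P>(w in M. y k w = b \<and> s j1 k w = c1 \<and> s j2 k w = c2 \<and> s j3 k w = c3))"
  proof eventually_elim
    case (elim N)
    obtain D where D: "D \<subseteq> peers N i" "card D = 3"
      using obtain_subset_with_card_n[OF elim] by blast
    then obtain j1 j2 j3 where "D = {j1, j2, j3}" "j1 \<noteq> j2" "j1 \<noteq> j3" "j2 \<noteq> j3"
      by (auto simp: card_3_iff)
    with D have ne: "peer_triples N i \<noteq> {}"
      by (auto simp: peer_triples_def)
    have fin: "finite (peer_triples N i)"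
      by (rule finite_subset[of _ "peers N i \<times> peers N i \<times> peers N i"])
        (auto simp: peer_triples_def finite_peers)
    have eq: "\<P>(w in M. y k w = b \<and> s j1 k w = c1 \<and> s j2 k w = c2 \<and> s j3 k w = c3)
        = ?a * (?q c1 j1 * ?q c2 j2 * ?q c3 j3)"
      if "(j1, j2, j3) \<in> peer_triples N i" for j1 j2 j3
    proof -
      have "?q c1 j1 * ?q c2 j2 * ?q c3 j3
          = \<P>(w in cond_y k b. s j1 k w = c1 \<and> s j2 k w = c2 \<and> s j3 k w = c3)"
        using that by (intro predictions_indep[symmetric]) (auto simp: peer_triples_def)
      then show ?thesis by (simp add: prob_and_y)
    qed
    show ?case
      unfolding integral_pmf_of_set[OF ne fin]
      by (auto simp: sum_distrib_left sum_divide_distrib eq intro!: sum.cong)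
  qed
  then show "(\<lambda>N. measure_pmf.expectation (?T N)
       (\<lambda>(j1, j2, j3). \<P>(w in M. y k w = b \<and> s j1 k w = c1 \<and> s j2 k w = c2 \<and> s j3 k w = c3)))
    \<longlonglongrightarrow> ?a * (\<P>(w in cond_y k b. z i k w = c1) * \<P>(w in cond_y k b. z i k w = c2) * \<P>(w in cond_y k b. z i k w = c3))"
    by (rule Lim_transform_eventually[OF lim])
qed

lemma prob_not_reference_given_y:
  "\<P>(w in cond_y k b. \<not> z i k w) = 1 - \<P>(w in cond_y k b. z i k w)"
proof -
  interpret C: prob_space "cond_y k b" by (rule prob_space_cond_y)
  show ?thesis by (rule C.prob_neg) measurable
qed

lemma prob_reference_given_y:
  "\<P>(w in cond_y k b. z i k w) = (if b then 1 - err_plus M (y k) (z i k) else err_minus M (y k) (z i k))"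
proof (cases b)
  case True
  then show ?thesis
    using prob_cond_y[of "\<lambda>w. \<not> z i k w" k True] prob_not_reference_given_y[of k b i]
    by (simp add: err_plus_def)
next
  case False
  then show ?thesis
    using prob_cond_y[of "z i k" k False] by (simp add: err_minus_def)
qed

text \<open>Total probability over \<open>y k\<close> writes the three probabilities as mixtures,
  with weights \<open>p\<close> and \<open>1 - p\<close>, of the first three powers of the
  conditional probability of \<open>z i k\<close>.\<close>

lemma ssr_solution_error_rates:
  "ssr_solution \<P>(w in M. z i k w) \<P>(w in M. z1 i k w \<and> z2 i k w) \<P>(w in M. z1 i k w \<and> z2 i k w \<and> z3 i k w)
    (p > 1/2) (p, err_minus M (y k) (z i k), err_plus M (y k) (z i k))"
proof -
  define r where "r b = \<P>(w in cond_y k b. z i k w)" for b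
  define a where "a b = \<P>(w in M. y k w = b)" for b
  have a: "a True = p" "a False = 1 - p"
    unfolding a_def prob_y by simp_all
  have r: "r True = 1 - err_plus M (y k) (z i k)" "r False = err_minus M (y k) (z i k)"
    unfolding r_def prob_reference_given_y by simp_all
  have split: "\<P>(w in M. Q w) = \<P>(w in M. y k w = True \<and> Q w) + \<P>(w in M. y k w = False \<and> Q w)"
    if "Measurable.pred M Q" for Q
    using prob_split_bool[OF that y_measurable, of k] by (simp add: conj_commute)
  have "\<P>(w in M. z i k w) = a True * r True + a False * r False"
    by (subst split) (simp_all only: prob_and_y a_def r_def z_measurable)
  moreover have z123: "\<P>(w in M. y k w = b \<and> z1 i k w \<and> z2 i k w \<and> z3 i k w) = a b * r b ^ 3" for b
    using triple_law[of k b i True True True] by (simp add: a_def r_def power3_eq_cube)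
  moreover have "\<P>(w in M. z1 i k w \<and> z2 i k w \<and> z3 i k w) = a True * r True ^ 3 + a False * r False ^ 3"
    by (subst split) (simp_all only: z123, measurable)
  \<comment> \<open>\<open>triple_law\<close> fixes all three reports, so the pair is obtained by
    summing over the value of \<open>z3\<close>: \<open>r^3 + r^2 * (1 - r) = r^2\<close>.\<close>
  moreover have z12: "\<P>(w in M. y k w = b \<and> z1 i k w \<and> z2 i k w) = a b * r b ^ 2" for b
  proof -
    have "\<P>(w in M. y k w = b \<and> z1 i k w \<and> z2 i k w)
        = \<P>(w in M. (y k w = b \<and> z1 i k w \<and> z2 i k w) \<and> z3 i k w)
          + \<P>(w in M. (y k w = b \<and> z1 i k w \<and> z2 i k w) \<and> \<not> z3 i k w)"
      by (rule prob_split_bool) measurable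
    also have "\<dots> = a b * r b ^ 3 + a b * (r b * r b * (1 - r b))"
      using z123[of b] triple_law[of k b i True True False] prob_not_reference_given_y[of k b i]
      by (simp add: a_def r_def conj_assoc)
    finally show ?thesis by (simp add: algebra_simps power2_eq_square power3_eq_cube)
  qed
  moreover have "\<P>(w in M. z1 i k w \<and> z2 i k w) = a True * r True ^ 2 + a False * r False ^ 2"
    by (subst split) (simp_all only: z12, measurable)
  ultimately show ?thesis
    by (simp add: ssr_solution_def a r)
qed

text \<open>By conditional independence, fixing agent \<open>i\<close>'s signal leaves the law of
  \<open>z i k\<close> given \<open>y k\<close> unchanged. In product form the identity also covers
  a signal that rules out the value \<open>b\<close>.\<close>

lemma prob_obs_reference:
  "\<P>(w in M. (y k w = b \<and> z i k w) \<and> obs i k w = v)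
    = \<P>(w in M. y k w = b \<and> obs i k w = v) * \<P>(w in cond_y k b. z i k w)"
proof -
  have "\<P>(w in M. (y k w = b \<and> z i k w) \<and> obs i k w = v) = \<P>(w in M. y k w = b \<and> (obs i k w = v \<and> z i k w))"
    by (intro arg_cong[where f=prob] Collect_cong) auto
  also have "\<dots> = \<P>(w in M. y k w = b) * \<P>(w in cond_y k b. obs i k w = v \<and> z i k w)"
    by (rule prob_and_y) measurable
  also have "\<dots> = \<P>(w in M. y k w = b) * \<P>(w in cond_y k b. obs i k w = v) * \<P>(w in cond_y k b. z i k w)"
    using reference_cond_indep[of k b i v True] by simp
  also have "\<P>(w in M. y k w = b) * \<P>(w in cond_y k b. obs i k w = v) = \<P>(w in M. y k w = b \<and> obs i k w = v)"
    by (rule prob_and_y[symmetric]) measurable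
  finally show ?thesis .
qed

end

section \<open>Expected payments under the prior and given a signal\<close>

theorem theorem5p5:
  fixes M :: "'w measure" and p :: real and Sig :: "nat \<Rightarrow> 's set"
    and y :: "nat \<Rightarrow> 'w \<Rightarrow> bool" and obs :: "nat \<Rightarrow> nat \<Rightarrow> 'w \<Rightarrow> 's"
    and \<sigma> :: "nat \<Rightarrow> real \<Rightarrow> real measure" and rpt :: "nat \<Rightarrow> nat \<Rightarrow> 'w \<Rightarrow> real"
    and s z z1 z2 z3 :: "nat \<Rightarrow> nat \<Rightarrow> 'w \<Rightarrow> bool"
    and S :: "real \<Rightarrow> bool \<Rightarrow> real" and ep em \<alpha> \<beta> \<gamma> :: real and i :: nat
  assumes setting: "asymptotic_elicitation M p Sig y obs \<sigma> rpt s z z1 z2 z3"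
    and proper: "strictly_proper S"
    and error_plus: "\<And>k. err_plus M (y k) (z i k) = ep"
    and error_minus: "\<And>k. err_minus M (y k) (z i k) = em"
    and alpha: "\<And>k. \<P>(w in M. z i k w) = \<alpha>"
    and beta: "\<And>k. \<P>(w in M. z1 i k w \<and> z2 i k w) = \<beta>"
    and gamma: "\<And>k. \<P>(w in M. z1 i k w \<and> z2 i k w \<and> z3 i k w) = \<gamma>"
    and informative: "ep + em \<noteq> 1"
  shows "\<forall>k. \<forall>q\<in>{0..1}.
      (LINT w|M. ssr_payment S \<alpha> \<beta> \<gamma> (p > 1/2) q (z i k w)) = (LINT w|M. S q (y k w))
    \<and> (\<forall>v. \<P>(w in M. obs i k w = v) > 0 \<longrightarrow>
        (LINT w|uniform_measure M {w \<in> space M. obs i k w = v}. ssr_payment S \<alpha> \<beta> \<gamma> (p > 1/2) q (z i k w))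
        = (LINT w|uniform_measure M {w \<in> space M. obs i k w = v}. S q (y k w)))"
proof (intro allI ballI conjI impI)
  fix k q
  interpret asymptotic_elicitation M p Sig y obs \<sigma> rpt s z z1 z2 z3 by (rule setting)
  have rate: "measure (cond_y k b) {w \<in> space M. z i k w} = (if b then 1 - ep else em)" for b
    using prob_reference_given_y[of k b i] by (simp add: error_plus error_minus)
  have "ssr_solution \<alpha> \<beta> \<gamma> (p > 1/2) (p, em, ep)"
    using ssr_solution_error_rates[of i k] by (simp add: alpha beta gamma error_plus error_minus)
  \<comment> \<open>From here on the payment, defined through \<open>THE\<close>, is the surrogate
    score with the true error rates.\<close>
  note payment = ssr_payment_eq_surrogate_score[OF prior_range informative this]
  show "(LINT w|M. ssr_payment S \<alpha> \<beta> \<gamma> (p > 1/2) q (z i k w)) = (LINT w|M. S q (y k w))"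
    unfolding payment
  proof (rule expectation_surrogate_score[OF _ _ informative])
    show "\<P>(w in M. y k w \<and> z i k w) = \<P>(w in M. y k w) * (1 - ep)"
      using prob_and_y[of "z i k" k True] by (simp add: rate)
    show "\<P>(w in M. \<not> y k w \<and> z i k w) = \<P>(w in M. \<not> y k w) * em"
      using prob_and_y[of "z i k" k False] by (simp add: rate)
  qed measurable
  fix v assume pos: "\<P>(w in M. obs i k w = v) > 0"
  define N where "N = uniform_measure M {w \<in> space M. obs i k w = v}"
  have [measurable_cong]: "sets N = sets M" and [simp]: "space N = space M" by (simp_all add: N_def)
  interpret N: prob_space N
    unfolding N_def using pos by (intro prob_space_uniform_measure) (auto simp: emeasure_eq_measure)
  have prob_N: "measure N {w \<in> space M. Q w} = \<P>(w in M. Q w \<and> obs i k w = v) / \<P>(w in M. obs i k w = v)"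
    if "Measurable.pred M Q" for Q
    unfolding N_def using measure_uniform_measure_eq_cond_prob[OF that, of "\<lambda>w. obs i k w = v"]
    by (simp add: cond_prob_def)
  \<comment> \<open>The rates \<open>ep\<close> and \<open>em\<close> persist under
    \<open>N\<close>, so the unbiasedness lemma applies to the law given the signal as it did to the
    prior law.\<close>
  have "(LINT w|N. surrogate_score S em ep q (z i k w)) = (LINT w|N. S q (y k w))"
  proof (rule N.expectation_surrogate_score[OF _ _ informative])
    show "\<P>(w in N. y k w \<and> z i k w) = \<P>(w in N. y k w) * (1 - ep)"
      using prob_obs_reference[of k True i v] by (simp add: prob_N rate)
    show "\<P>(w in N. \<not> y k w \<and> z i k w) = \<P>(w in N. \<not> y k w) * em"
      using prob_obs_reference[of k False i v] by (simp add: prob_N rate)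
  qed measurable
  then show "(LINT w|uniform_measure M {w \<in> space M. obs i k w = v}. ssr_payment S \<alpha> \<beta> \<gamma> (p > 1/2) q (z i k w))
      = (LINT w|uniform_measure M {w \<in> space M. obs i k w = v}. S q (y k w))"
    unfolding payment N_def .
qed

end
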